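(* Let $c_1,\dots,c_d$ be complex constants such that the characteristic polynomial $t^d-c_1t^{d-1}-\cdots-c_d$ has $d$ distinct nonzero roots $r_1,\dots,r_d$, and let $p$ be a positive integer such that no product $r_{m_1}r_{m_2}\cdots r_{m_p}$ (with $1\le m_j\le d$, repetitions allowed) equals $1$. Then there exist constants $\Lambda_{i_1,\dots,i_p}$ ($0\le i_1,\dots,i_p\le d-1$), depending only on $c_1,\dots,c_d$ and $p$, such that for every sequence $F$ satisfying $F(n)=c_1F(n-1)+\cdots+c_dF(n-d)$, whatever its initial values $F(0),\dots,F(d-1)$, there is a constant $K$ (which may depend on the initial values) with $$\sum_{j=0}^{n-1}F(j)^p=\sum_{0\le i_1,\dots,i_p\le d-1}\Lambda_{i_1,\dots,i_p}F(n+i_1)\cdots F(n+i_p)+K\qquad\text{for all } n\ge0.$$ *)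

theory Defs
  imports
    Complex_Main
    "HOL-Computational_Algebra.Polynomial"
    "HOL-Library.FuncSet"
begin

text \<open>The coefficients \<open>c\<close> and the roots are indexed from \<open>1\<close>; values of \<open>c\<close> outside \<open>{1..d}\<close> are never used.\<close>

definition rec_char_poly :: "nat \<Rightarrow> (nat \<Rightarrow> complex) \<Rightarrow> complex poly" where
  "rec_char_poly d c = monom 1 d - (\<Sum>i=1..d. monom (c i) (d - i))"

text \<open>Sequences start at index \<open>0\<close>, so the recurrence is imposed from index \<open>d\<close> on and
  \<open>F 0, \<dots>, F (d - 1)\<close> are free; in particular \<open>n - i\<close> below is never truncated.\<close>

definition satisfies_recurrence :: "nat \<Rightarrow> (nat \<Rightarrow> complex) \<Rightarrow> (nat \<Rightarrow> complex) \<Rightarrow> bool" where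
  "satisfies_recurrence d c F \<longleftrightarrow> (\<forall>n\<ge>d. F n = (\<Sum>i=1..d. c i * F (n - i)))"

text \<open>A tuple \<open>(i\<^sub>1, \<dots>, i\<^sub>p)\<close> with entries in \<open>A\<close> is a function on \<open>{1..p}\<close>, made extensional
  (undefined elsewhere) so that distinct elements are distinct tuples and the set is finite for finite \<open>A\<close>.\<close>

definition tuples :: "nat \<Rightarrow> 'a set \<Rightarrow> (nat \<Rightarrow> 'a) set" where
  "tuples p A = {1..p} \<rightarrow>\<^sub>E A"

end

theory Submission
  imports Defs
begin

text \<open>
  Let \<open>\<chi>\<close> be the characteristic polynomial and let polynomials act on sequences with the
  indeterminate as the shift. The Lagrange basis polynomials \<open>L m\<close> of the roots sum to \<open>1\<close>,
  and \<open>(X - r m) L m\<close> is a multiple of \<open>\<chi>\<close>, which kills \<open>F\<close>. Hence \<open>F\<close> is the sum of the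
  geometric sequences \<open>L m F\<close> with ratios \<open>r m\<close>, each a fixed linear form in
  \<open>F n, \<dots>, F (n + d - 1)\<close>. Expanding \<open>F n ^ p\<close> gives geometric sequences whose ratios are
  products of \<open>p\<close> roots, thus not \<open>1\<close>, and the sum of such a sequence is a multiple of its
  last term plus a constant.
\<close>

definition shift_apply :: "'a::comm_ring_1 poly \<Rightarrow> (nat \<Rightarrow> 'a) \<Rightarrow> nat \<Rightarrow> 'a" where
  "shift_apply P F n = (\<Sum>i\<le>degree P. coeff P i * F (n + i))"

text \<open>Coefficients beyond the degree vanish, so polynomials of different degrees can be summed
  over one common index range.\<close>

lemma shift_apply_altdef:
  assumes "degree P \<le> N"
  shows "shift_apply P F n = (\<Sum>i\<le>N. coeff P i * F (n + i))"
  unfolding shift_apply_def using assms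
  by (intro sum.mono_neutral_left) (auto simp: coeff_eq_0)

lemma shift_apply_0 [simp]: "shift_apply 0 F n = 0"
  and shift_apply_1 [simp]: "shift_apply 1 F n = F n"
  by (simp_all add: shift_apply_def)

lemma shift_apply_add: "shift_apply (P + Q) F n = shift_apply P F n + shift_apply Q F n"
proof -
  define N where "N = max (degree P) (degree Q)"
  have "degree P \<le> N" "degree Q \<le> N" "degree (P + Q) \<le> N"
    by (auto simp: N_def degree_add_le_max)
  then show ?thesis
    by (simp add: shift_apply_altdef[where N = N] sum.distrib algebra_simps)
qed

lemma shift_apply_smult: "shift_apply (smult a P) F n = a * shift_apply P F n"
  by (simp add: shift_apply_altdef[where N = "degree P"] degree_smult_le sum_distrib_left mult.assoc)

lemma shift_apply_minus: "shift_apply (- P) F n = - shift_apply P F n"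
  by (simp add: shift_apply_def sum_negf)

lemma shift_apply_diff: "shift_apply (P - Q) F n = shift_apply P F n - shift_apply Q F n"
  using shift_apply_add[of P "- Q" F n] by (simp add: shift_apply_minus)

lemma shift_apply_sum: "shift_apply (\<Sum>a\<in>A. P a) F n = (\<Sum>a\<in>A. shift_apply (P a) F n)"
  by (induction A rule: infinite_finite_induct) (simp_all add: shift_apply_add)

lemma shift_apply_monom: "shift_apply (monom a k) F n = a * F (n + k)"
proof -
  have "shift_apply (monom a k) F n = (\<Sum>i\<le>k. if i = k then a * F (n + k) else 0)"
    unfolding shift_apply_altdef[OF degree_monom_le] by (intro sum.cong) auto
  then show ?thesis by simp
qed

lemma shift_apply_pCons_0: "shift_apply (pCons 0 P) F n = shift_apply P F (Suc n)"
proof -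
  have "shift_apply (pCons 0 P) F n = (\<Sum>i\<le>Suc (degree P). coeff (pCons 0 P) i * F (n + i))"
    by (rule shift_apply_altdef) (simp add: degree_pCons_le)
  also have "\<dots> = shift_apply P F (Suc n)"
    by (subst sum.atMost_Suc_shift) (simp add: shift_apply_def)
  finally show ?thesis .
qed

text \<open>If the product on the left kills \<open>F\<close>, this makes
  \<open>shift_apply P F\<close> geometric with ratio \<open>a\<close>.\<close>

lemma shift_apply_linear_mult:
  "shift_apply ([:-a, 1:] * P) F n = shift_apply P F (Suc n) - a * shift_apply P F n"
  using shift_apply_diff[of "pCons 0 P" "smult a P" F n]
  by (simp add: shift_apply_smult shift_apply_pCons_0)

text \<open>The cofactor of \<open>X - a\<close> in \<open>P\<close> vanishes on the rest of
  \<open>A\<close>; dividing it by its value at \<open>a\<close> gives \<open>L a\<close>. The sum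
  of the \<open>L a\<close> and \<open>1\<close> agree on \<open>A\<close> and have degree below
  \<open>card A\<close>, so they coincide.\<close>

lemma lagrange_basis_exists:
  fixes P :: "'a::field poly"
  assumes "degree P = card A" and "card A > 0"
    and roots: "\<And>a. a \<in> A \<Longrightarrow> poly P a = 0"
  obtains L k where "\<And>a. a \<in> A \<Longrightarrow> degree (L a) < card A"
    and "\<And>a. a \<in> A \<Longrightarrow> [:-a, 1:] * L a = smult (k a) P"
    and "(\<Sum>a\<in>A. L a) = 1"
proof -
  define Q where "Q a = synthetic_div P a" for a
  define L where "L a = smult (inverse (poly (Q a) a)) (Q a)" for a
  have fin: "finite A" using assms(2) card_ge_0_finite by blast
  have P_eq: "P = [:-a, 1:] * Q a" if "a \<in> A" for a
    using synthetic_div_correct'[of a P] roots[OF that] by (simp add: Q_def)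
  have deg_Q: "degree (Q a) < card A" for a
    using assms(1,2) by (simp add: Q_def degree_synthetic_div)
  have Q_other: "poly (Q a) b = 0" if "a \<in> A" "b \<in> A" "a \<noteq> b" for a b
  proof -
    have "poly ([:-a, 1:] * Q a) b = 0" using P_eq[OF that(1)] roots[OF that(2)] by metis
    then show ?thesis using that(3) by simp
  qed
  have Q_self: "poly (Q a) a \<noteq> 0" if "a \<in> A" for a
  proof
    \<comment> \<open>Otherwise \<open>Q a\<close> would vanish on all of \<open>A\<close>, more
      points than its degree allows.\<close>
    assume "poly (Q a) a = 0"
    then have "Q a = 0"
      using Q_other[OF that] deg_Q[of a] assms(2) by (intro poly_eqI_degree[of A]) force+
    then have "P = 0" using P_eq[OF that] by simp
    then show False using assms(1,2) by simp
  qed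
  have L_eval: "poly (L a) b = (if a = b then 1 else 0)" if "a \<in> A" "b \<in> A" for a b
    using Q_other[OF that] Q_self[OF that(1)] by (auto simp: L_def)
  have deg_L: "degree (L a) < card A" for a
    using deg_Q[of a] by (simp add: L_def)
  show thesis
  proof
    show "degree (L a) < card A" for a by (rule deg_L)
    show "[:-a, 1:] * L a = smult (inverse (poly (Q a) a)) P" if "a \<in> A" for a
      by (subst P_eq[OF that]) (simp only: L_def mult_smult_right)
    show "(\<Sum>a\<in>A. L a) = 1"
    proof (rule poly_eqI_degree[of A])
      show "poly (\<Sum>a\<in>A. L a) b = poly 1 b" if "b \<in> A" for b
        using that fin by (simp add: poly_sum L_eval cong: sum.cong)
      show "degree (\<Sum>a\<in>A. L a) < card A"
        by (rule degree_sum_less[OF deg_L assms(2)])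
    qed (use assms(2) in simp)
  qed
qed

lemma degree_rec_char_poly:
  assumes "d \<ge> 1"
  shows "degree (rec_char_poly d c) = d"
proof -
  have "degree (\<Sum>i=1..d. monom (c i) (d - i)) < d"
    using assms by (intro degree_sum_less) (auto intro: le_less_trans[OF degree_monom_le])
  then show ?thesis
    unfolding rec_char_poly_def diff_conv_add_uminus
    by (subst degree_add_eq_left) (simp_all add: degree_monom_eq)
qed

lemma shift_apply_rec_char_poly:
  assumes "satisfies_recurrence d c F"
  shows "shift_apply (rec_char_poly d c) F n = 0"
proof -
  have "F (n + d) = (\<Sum>i=1..d. c i * F (n + d - i))"
    using assms unfolding satisfies_recurrence_def by simp
  also have "\<dots> = (\<Sum>i=1..d. c i * F (n + (d - i)))"
    by (intro sum.cong) auto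
  finally show ?thesis
    by (simp add: rec_char_poly_def shift_apply_diff shift_apply_sum shift_apply_monom)
qed

lemma sum_geometric_sequence:
  fixes w :: "nat \<Rightarrow> 'a::field"
  assumes "\<And>n. w (Suc n) = q * w n" and "q \<noteq> 1"
  shows "(\<Sum>j<n. w j) = w n / (q - 1) - w 0 / (q - 1)"
proof -
  \<comment> \<open>A discrete antiderivative: \<open>w (Suc n) - w n = (q - 1) * w n\<close>, so
    the sum telescopes.\<close>
  define v where "v n = w n / (q - 1)" for n
  have "v (Suc n) - v n = (q - 1) * w n / (q - 1)" for n
    by (simp add: v_def assms(1) left_diff_distrib diff_divide_distrib)
  then have "w = (\<lambda>n. v (Suc n) - v n)"
    using assms(2) by auto
  then have "(\<Sum>j<n. w j) = v n - v 0"
    by (simp only: sum_lessThan_telescope)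
  then show ?thesis
    by (simp only: v_def)
qed

theorem theorem4:
  fixes d p :: nat and c r :: "nat \<Rightarrow> complex"
  assumes "d \<ge> 1" and "p \<ge> 1"
    and "inj_on r {1..d}"
    and "\<And>m. m \<in> {1..d} \<Longrightarrow> r m \<noteq> 0"
    and "\<And>m. m \<in> {1..d} \<Longrightarrow> poly (rec_char_poly d c) (r m) = 0"
    and "\<And>m. m \<in> tuples p {1..d} \<Longrightarrow> (\<Prod>j=1..p. r (m j)) \<noteq> 1"
  shows "\<exists>\<Lambda> :: (nat \<Rightarrow> nat) \<Rightarrow> complex.
           \<forall>F :: nat \<Rightarrow> complex. satisfies_recurrence d c F \<longrightarrow>
             (\<exists>K :: complex. \<forall>n :: nat.
                (\<Sum>j<n. F j ^ p)
                  = (\<Sum>i\<in>tuples p {0..d - 1}. \<Lambda> i * (\<Prod>k=1..p. F (n + i k))) + K)"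
proof -
  let ?A = "r ` {1..d}"
  have card: "card ?A = d" using assms(3) by (simp add: card_image)
  have deg: "degree (rec_char_poly d c) = card ?A" and pos: "card ?A > 0"
    using assms(1) by (simp_all only: card degree_rec_char_poly)
  have roots: "poly (rec_char_poly d c) a = 0" if "a \<in> ?A" for a
    using that assms(5) by auto
  obtain L k where deg_L: "\<And>a. a \<in> ?A \<Longrightarrow> degree (L a) < card ?A"
    and L_mult: "\<And>a. a \<in> ?A \<Longrightarrow> [:-a, 1:] * L a = smult (k a) (rec_char_poly d c)"
    and L_sum: "(\<Sum>a\<in>?A. L a) = 1"
    using lagrange_basis_exists[OF deg pos roots] by blast
  define \<rho> where "\<rho> m = (\<Prod>j=1..p. r (m j))" for m :: "nat \<Rightarrow> nat"
  \<comment> \<open>The coefficient of the product of the \<open>F (n + i j)\<close> once every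
    \<open>w m n / (\<rho> m - 1)\<close> below is expanded. It is fixed before \<open>F\<close>, so
    it cannot depend on initial values.\<close>
  define \<Lambda> where "\<Lambda> i = (\<Sum>m\<in>tuples p {1..d}. (\<Prod>j=1..p. coeff (L (r (m j))) (i j)) / (\<rho> m - 1))"
    for i :: "nat \<Rightarrow> nat"
  show ?thesis
  proof (intro exI[of _ \<Lambda>] allI impI)
    fix F :: "nat \<Rightarrow> complex"
    assume rec: "satisfies_recurrence d c F"
    define u where "u l n = shift_apply (L (r l)) F n" for l n
    define w where "w m n = (\<Prod>j=1..p. u (m j) n)" for m :: "nat \<Rightarrow> nat" and n
    \<comment> \<open>Since \<open>L (r l)\<close> has degree below \<open>d\<close>, the shifts can
      be padded to the range required of the tuples.\<close>
    have u_eq: "u l n = (\<Sum>i\<in>{0..d - 1}. coeff (L (r l)) i * F (n + i))"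
      if "l \<in> {1..d}" for l n
      using deg_L[of "r l"] that card unfolding u_def atLeast0AtMost
      by (intro shift_apply_altdef) auto
    have u_Suc: "u l (Suc n) = r l * u l n" if "l \<in> {1..d}" for l n
      using shift_apply_linear_mult[of "r l" "L (r l)" F n] L_mult[of "r l"] that
        shift_apply_rec_char_poly[OF rec, of n]
      by (simp add: shift_apply_smult u_def del: mult_pCons_left)
    \<comment> \<open>Both sides of \<open>L_sum\<close> act on \<open>F\<close>; injectivity of
      \<open>r\<close> turns the sum over roots into one over indices.\<close>
    have F_eq: "F n = (\<Sum>l=1..d. u l n)" for n
      using arg_cong[OF L_sum, of "\<lambda>P. shift_apply P F n"] assms(3)
      by (simp add: shift_apply_sum u_def sum.reindex)
    have F_power: "F n ^ p = (\<Sum>m\<in>tuples p {1..d}. w m n)" for n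
    proof -
      have "F n ^ p = (\<Prod>j=1..p. \<Sum>l=1..d. u l n)" by (simp add: F_eq)
      also have "\<dots> = (\<Sum>m\<in>tuples p {1..d}. w m n)"
        unfolding tuples_def w_def by (rule prod_sum_PiE) simp_all
      finally show ?thesis .
    qed
    have w_Suc: "w m (Suc n) = \<rho> m * w m n" if "m \<in> tuples p {1..d}" for m n
    proof -
      have "w m (Suc n) = (\<Prod>j=1..p. r (m j) * u (m j) n)"
        unfolding w_def using that by (intro prod.cong u_Suc) (auto simp: tuples_def)
      then show ?thesis by (simp add: w_def \<rho>_def prod.distrib)
    qed
    have w_eq: "w m n = (\<Sum>i\<in>tuples p {0..d - 1}.
        (\<Prod>j=1..p. coeff (L (r (m j))) (i j)) * (\<Prod>j=1..p. F (n + i j)))"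
      if "m \<in> tuples p {1..d}" for m n
    proof -
      have "w m n = (\<Prod>j=1..p. \<Sum>i\<in>{0..d - 1}. coeff (L (r (m j))) i * F (n + i))"
        unfolding w_def using that by (intro prod.cong u_eq) (auto simp: tuples_def)
      then show ?thesis by (simp add: prod_sum_PiE tuples_def prod.distrib)
    qed
    \<comment> \<open>The lower boundary terms of the telescoped sums; they depend on
      \<open>F\<close> but not on \<open>n\<close>.\<close>
    define K where "K = - (\<Sum>m\<in>tuples p {1..d}. w m 0 / (\<rho> m - 1))"
    have "(\<Sum>j<n. F j ^ p)
        = (\<Sum>i\<in>tuples p {0..d - 1}. \<Lambda> i * (\<Prod>k=1..p. F (n + i k))) + K" for n
    proof -
      have "(\<Sum>j<n. F j ^ p) = (\<Sum>m\<in>tuples p {1..d}. \<Sum>j<n. w m j)"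
        unfolding F_power by (rule sum.swap)
      \<comment> \<open>The hypothesis on products of roots enters here: it gives
        \<open>\<rho> m \<noteq> 1\<close> for every tuple.\<close>
      also have "\<dots> = (\<Sum>m\<in>tuples p {1..d}. w m n / (\<rho> m - 1) - w m 0 / (\<rho> m - 1))"
        using assms(6) w_Suc by (intro sum.cong sum_geometric_sequence) (auto simp: \<rho>_def)
      also have "\<dots> = (\<Sum>m\<in>tuples p {1..d}. w m n / (\<rho> m - 1)) + K"
        by (simp add: sum_subtractf K_def)
      also have "(\<Sum>m\<in>tuples p {1..d}. w m n / (\<rho> m - 1))
          = (\<Sum>m\<in>tuples p {1..d}. \<Sum>i\<in>tuples p {0..d - 1}.
              (\<Prod>j=1..p. coeff (L (r (m j))) (i j)) / (\<rho> m - 1) * (\<Prod>j=1..p. F (n + i j)))"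
        by (intro sum.cong) (simp_all add: w_eq sum_divide_distrib)
      also have "\<dots> = (\<Sum>i\<in>tuples p {0..d - 1}. \<Lambda> i * (\<Prod>j=1..p. F (n + i j)))"
        unfolding \<Lambda>_def sum_distrib_right by (rule sum.swap)
      finally show ?thesis .
    qed
    then show "\<exists>K. \<forall>n. (\<Sum>j<n. F j ^ p)
        = (\<Sum>i\<in>tuples p {0..d - 1}. \<Lambda> i * (\<Prod>k=1..p. F (n + i k))) + K"
      by blast
  qed
qed

end
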